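(* Let $d\ge2$ and suppose that the percolation measure $\mathbb P$ on $\{0,1\}^{E_d}$ satisfies the ergodicity/infinite cluster hypothesis (A) and the large-scale regularity hypothesis (B) stated in the context. For $\mathbb P_0$-a.e. $\omega$, let $W^\omega:\mathcal C_\infty(\omega)\times\mathcal C_\infty(\omega)\to(0,\infty)$ be a symmetric weight function and $\theta^\omega:\mathcal C_\infty(\omega)\to(0,\infty)$ a reference measure such that, for $\mathbb P_0$-a.e. $\omega$, $\inf_{y\in\mathcal C_\infty(\omega)}\theta^\omega(y)>0$. Assume further that there exist $p,q\in(1,\infty]$ with $\frac1p+\frac1q<\frac2d$ such that for $\mathbb P_0$-a.e. $\omega$, $$\sup_{R\ge1}\Bigl(\|1\vee\theta^\omega\|_{p,B^\omega(0,R)}+\|1\vee\nu^\omega\|_{q,B^\omega(0,R)}\Bigr)<\infty.$$ Then for every $m\ge2$ there exist $\alpha,\beta,\gamma\in(0,1)$, independent of $\omega$, with $\alpha+\beta+\gamma=1$, and, for $\mathbb P_0$-a.e. $\omega$, a constant $C_{10}(\omega)\in(0,\infty)$ such that for every $f:\mathcal C_\infty(\omega)\to\mathbb R$, $$\|f\|^2_{\ell^2(\mathcal C_\infty(\omega),\theta^\omega)}\;\le\;C_{10}(\omega)\,\mathcal E^\omega(f)^{\alpha}\,\|f\|^{2\beta}_{\ell^1(\mathcal C_\infty(\omega),\theta^\omega)}\,\|(\eta^\omega)^{m/2}f\|^{2\gamma}_{\ell^2(\mathcal C_\infty(\omega),\theta^\omega)},$$ where $\eta^\omega(y):=\max\{1,d^\omega(0,y)\}$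 and $$\mathcal E^\omega(f):=\frac12\sum_{x,y\in\mathcal C_\infty(\omega),\,y\sim x}W^\omega(x,y)\bigl(f(y)-f(x)\bigr)^2.$$
   Context: Bond percolation on $(\mathbb Z^d,E_d)$, $E_d$ the nearest-neighbour edges: $\Omega=\{0,1\}^{E_d}$ (with $\sigma$-algebra $\mathcal F$); an edge $e$ is open if $\omega(e)=1$; $\mathcal O(\omega)$ is the set of open edges; $\mathcal C_\infty(\omega)$ is the set of vertices belonging to infinite connected components of open edges. $\tau_x$, $x\in\mathbb Z^d$, are the space shifts on $\Omega$. $\mathbb P$ is a probability measure on $\Omega$. (A) $\mathbb P$ is stationary and ergodic under the shifts ($\mathbb P\circ\tau_x^{-1}=\mathbb P$ for all $x$; $\mathbb P[A]\in\{0,1\}$ if $\tau_x^{-1}(A)=A$ for all $x$); for $\mathbb P$-a.e. $\omega$ the set $\mathcal C_\infty(\omega)$ is non-empty and there is a unique infinite connected component; and $\mathbb P[0\in\mathcal C_\infty]>0$. Put $\mathbb P_0[\cdot]:=\mathbb P[\cdot\mid0\in\mathcal C_\infty]$. Notation: $d^\omega$ is the graph distance on $\mathcal C_\infty(\omega)$ with edges $\{\{x,y\}\in\mathcal O(\omega):x,y\in\mathcal C_\infty(\omega)\}$; $x\sim y$ for $x,y\in\mathcal C_\infty(\omega)$ means $d^\omega(x,y)=1$; $B^\omega(x,R):=\{y\in\mathcal C_\infty(\omega):d^\omega(x,y)\le\lfloor R\rfloor\}$; $Q^\omega(x,R):=\mathcal C_\infty(\omega)\cap\{z\in\mathbb Z^d:|x-z|_\infty\le\lfloor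 R\rfloor\}$; for $A\subset B\subset\mathbb Z^d$, $\partial^\omega_BA:=\{\{x,y\}\in\mathcal O(\omega):x\in A,\ y\in B\setminus A\}$. (B) There is $\alpha_0\in(0,1/2)$ such that for $\mathbb P_0$-a.e. $\omega$ and any $d'>d$ there exist a random constant $R_2(\omega)>0$ and non-random constants $C_7,C_8,C_9\in(0,\infty)$ such that for all $R\ge R_2(\omega)$ and $C_7R^{\alpha_0}\le r\le R$: (i) for all $x,y\in B^\omega(0,R)$: $C_8|x-y|_\infty\le d^\omega(x,y)\le C_9\max\{|x-y|_\infty,R^{\alpha_0}\}$; (ii) for all $x\in B^\omega(0,R)$: $C_8r^d\le|B^\omega(x,r)|\le C_9r^d$ and $C_8r^d\le|Q^\omega(x,r)|\le C_9r^d$; (iii) for all $x\in B^\omega(0,R)$: $\inf\bigl\{|\partial^\omega_{Q^\omega(x,r)}A|\,/\,|A|^{1-1/d'}:\ \emptyset\ne A\subset Q^\omega(x,r),\ |A|\le\frac12|Q^\omega(x,r)|\bigr\}\ge C_8\,r^{d/d'-1}$. $\nu^\omega(x):=\sum_{y\in\mathcal C_\infty(\omega),\,y\sim x}W^\omega(x,y)^{-1}$. Norms: for finite $A$, $\|f\|_{p,A}:=\bigl(\frac1{|A|}\sum_{A}|f|^p\bigr)^{1/p}$ for $p<\infty$, $\|f\|_{\infty,A}:=\max_A|f|$; $\|f\|_{\ell^p(\mathcal C_\infty(\omega),\theta^\omega)}:=\bigl(\sum_{x\in\mathcal C_\infty(\omega)}|f(x)|^p\theta^\omega(x)\bigr)^{1/p}$.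 All quantities may be $+\infty$; in the right-hand side products $0\cdot\infty$ is read as $\infty$. *)

theory Defs
  imports "HOL-Probability.Probability"
begin

section \<open>Bond percolation on the integer lattice\<close>

type_synonym 'd lattice = "int ^ 'd"

definition sup_norm :: "'d::finite lattice \<Rightarrow> int" where
  "sup_norm x = (MAX i. \<bar>x $ i\<bar>)"

definition lattice_edges :: "'d::finite lattice set set" where
  "lattice_edges = {{x, y} | x y. (\<Sum>i\<in>UNIV. \<bar>x $ i - y $ i\<bar>) = 1}"

text \<open>The two states of an edge are encoded as booleans. A configuration is a function that is
  extensional on the edge set: its value outside \<^const>\<open>lattice_edges\<close> carries no information.\<close>

type_synonym 'd config = "'d lattice set \<Rightarrow> bool"

definition config_space :: "'d::finite config measure" where
  "config_space = Pi\<^sub>M lattice_edges (\<lambda>_. count_space UNIV)"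

definition shift :: "'d::finite lattice \<Rightarrow> 'd config \<Rightarrow> 'd config" where
  "shift x \<omega> = (\<lambda>e\<in>lattice_edges. \<omega> ((+) x ` e))"

definition open_edges :: "'d::finite config \<Rightarrow> 'd lattice set set" where
  "open_edges \<omega> = {e \<in> lattice_edges. \<omega> e}"

definition open_component :: "'d::finite config \<Rightarrow> 'd lattice \<Rightarrow> 'd lattice set" where
  "open_component \<omega> x = {(u, v). {u, v} \<in> open_edges \<omega>}\<^sup>* `` {x}"

definition infinite_components :: "'d::finite config \<Rightarrow> 'd lattice set set" where
  "infinite_components \<omega> = {K. infinite K \<and> (\<exists>x. K = open_component \<omega> x)}"

definition inf_cluster :: "'d::finite config \<Rightarrow> 'd lattice set" where
  "inf_cluster \<omega> = \<Union>(infinite_components \<omega>)"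

text \<open>The graph distance is extended: it is \<open>\<infinity>\<close> between points that no path joins.\<close>

definition cluster_adj :: "'d::finite config \<Rightarrow> 'd lattice rel" where
  "cluster_adj \<omega> = {(x, y). {x, y} \<in> open_edges \<omega> \<and> x \<in> inf_cluster \<omega> \<and> y \<in> inf_cluster \<omega>}"

definition gdist :: "'d::finite config \<Rightarrow> 'd lattice \<Rightarrow> 'd lattice \<Rightarrow> enat" where
  "gdist \<omega> x y = (INF n\<in>{n. (x, y) \<in> cluster_adj \<omega> ^^ n}. enat n)"

definition nbr :: "'d::finite config \<Rightarrow> 'd lattice \<Rightarrow> 'd lattice \<Rightarrow> bool" where
  "nbr \<omega> x y \<longleftrightarrow> x \<in> inf_cluster \<omega> \<and> y \<in> inf_cluster \<omega> \<and> gdist \<omega> x y = 1"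

text \<open>The radii below are only ever nonnegative; \<^const>\<open>nat\<close> truncates negative ones.\<close>

definition gball :: "'d::finite config \<Rightarrow> 'd lattice \<Rightarrow> real \<Rightarrow> 'd lattice set" where
  "gball \<omega> x R = {y \<in> inf_cluster \<omega>. gdist \<omega> x y \<le> enat (nat \<lfloor>R\<rfloor>)}"

definition gbox :: "'d::finite config \<Rightarrow> 'd lattice \<Rightarrow> real \<Rightarrow> 'd lattice set" where
  "gbox \<omega> x R = {z \<in> inf_cluster \<omega>. sup_norm (x - z) \<le> \<lfloor>R\<rfloor>}"

definition rel_boundary ::
    "'d::finite config \<Rightarrow> 'd lattice set \<Rightarrow> 'd lattice set \<Rightarrow> 'd lattice set set" where
  "rel_boundary \<omega> B A = {e \<in> open_edges \<omega>. \<exists>x\<in>A. \<exists>y\<in>B - A. e = {x, y}}"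


section \<open>The hypotheses on the percolation measure\<close>

definition ergodic_inf_cluster :: "'d::finite config measure \<Rightarrow> bool" where
  "ergodic_inf_cluster P \<longleftrightarrow>
     (\<forall>x. distr P P (shift x) = P) \<and>
     (\<forall>A\<in>sets P. (\<forall>x. shift x -` A \<inter> space P = A) \<longrightarrow> measure P A \<in> {0, 1}) \<and>
     (AE \<omega> in P. inf_cluster \<omega> \<noteq> {} \<and> (\<exists>!K. K \<in> infinite_components \<omega>)) \<and>
     measure P {\<omega> \<in> space P. 0 \<in> inf_cluster \<omega>} > 0"

definition cond_meas :: "'d::finite config measure \<Rightarrow> 'd config measure" where
  "cond_meas P = uniform_measure P {\<omega> \<in> space P. 0 \<in> inf_cluster \<omega>}"

text \<open>The infimum is taken in \<^typ>\<open>ennreal\<close>, so that it is \<open>\<infinity>\<close> when no set \<open>A\<close> is admissible.\<close>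

definition regular_at_scale ::
    "'d::finite config \<Rightarrow> real \<Rightarrow> real \<Rightarrow> real \<Rightarrow> real \<Rightarrow> real \<Rightarrow> real \<Rightarrow> bool" where
  "regular_at_scale \<omega> \<alpha>\<^sub>0 d' C\<^sub>8 C\<^sub>9 R r \<longleftrightarrow>
     (\<forall>x\<in>gball \<omega> 0 R. \<forall>y\<in>gball \<omega> 0 R.
        ennreal (C\<^sub>8 * of_int (sup_norm (x - y))) \<le> ennreal_of_enat (gdist \<omega> x y) \<and>
        ennreal_of_enat (gdist \<omega> x y) \<le> ennreal (C\<^sub>9 * max (of_int (sup_norm (x - y))) (R powr \<alpha>\<^sub>0))) \<and>
     (\<forall>x\<in>gball \<omega> 0 R.
        C\<^sub>8 * r ^ CARD('d) \<le> real (card (gball \<omega> x r)) \<and>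
        real (card (gball \<omega> x r)) \<le> C\<^sub>9 * r ^ CARD('d) \<and>
        C\<^sub>8 * r ^ CARD('d) \<le> real (card (gbox \<omega> x r)) \<and>
        real (card (gbox \<omega> x r)) \<le> C\<^sub>9 * r ^ CARD('d)) \<and>
     (\<forall>x\<in>gball \<omega> 0 R.
        ennreal (C\<^sub>8 * r powr (real CARD('d) / d' - 1)) \<le>
        (INF A\<in>{A. A \<noteq> {} \<and> A \<subseteq> gbox \<omega> x r \<and> real (card A) \<le> 1/2 * real (card (gbox \<omega> x r))}.
           ennreal (real (card (rel_boundary \<omega> (gbox \<omega> x r) A)) / real (card A) powr (1 - 1 / d'))))"

text \<open>The non-random constants may depend on \<open>d'\<close>, hence they are chosen after \<open>d'\<close> and before
  the configuration; the random radius \<open>R\<^sub>2\<close> is chosen after both.\<close>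

definition large_scale_regular :: "'d::finite config measure \<Rightarrow> bool" where
  "large_scale_regular P \<longleftrightarrow>
     (\<exists>\<alpha>\<^sub>0. 0 < \<alpha>\<^sub>0 \<and> \<alpha>\<^sub>0 < 1/2 \<and>
       (\<forall>d'. d' > real CARD('d) \<longrightarrow>
         (\<exists>C\<^sub>7 C\<^sub>8 C\<^sub>9. 0 < C\<^sub>7 \<and> 0 < C\<^sub>8 \<and> 0 < C\<^sub>9 \<and>
           (AE \<omega> in cond_meas P. \<exists>R\<^sub>2>0. \<forall>R r.
              R\<^sub>2 \<le> R \<and> C\<^sub>7 * R powr \<alpha>\<^sub>0 \<le> r \<and> r \<le> R \<longrightarrow> regular_at_scale \<omega> \<alpha>\<^sub>0 d' C\<^sub>8 C\<^sub>9 R r))))"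


section \<open>Norms and energy\<close>

definition nu :: "('d::finite config \<Rightarrow> 'd lattice \<Rightarrow> 'd lattice \<Rightarrow> real) \<Rightarrow> 'd config \<Rightarrow> 'd lattice \<Rightarrow> real"
  where "nu W \<omega> x = (\<Sum>y | nbr \<omega> x y. inverse (W \<omega> x y))"

text \<open>Normalised norm on a finite nonempty set, with exponent in \<open>(0,\<infinity>]\<close>.\<close>

definition avg_norm :: "ennreal \<Rightarrow> 'a set \<Rightarrow> ('a \<Rightarrow> real) \<Rightarrow> real" where
  "avg_norm p A f =
     (if p = \<infinity> then (MAX x\<in>A. \<bar>f x\<bar>)
      else (1 / real (card A) * (\<Sum>x\<in>A. \<bar>f x\<bar> powr enn2real p)) powr (1 / enn2real p))"

text \<open>Powers with a positive real exponent.\<close>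

definition epowr :: "ennreal \<Rightarrow> real \<Rightarrow> ennreal" (infixr "epowr" 80) where
  "x epowr a = (if x = \<infinity> then \<infinity> else ennreal (enn2real x powr a))"

text \<open>Product with the convention \<open>0 \<cdot> \<infinity> = \<infinity>\<close>, whereas multiplication on \<^typ>\<open>ennreal\<close> has
  \<open>0 * \<infinity> = 0\<close>.\<close>

definition times_inf :: "ennreal \<Rightarrow> ennreal \<Rightarrow> ennreal" (infixl "\<odot>" 70) where
  "x \<odot> y = (if x = \<infinity> \<or> y = \<infinity> then \<infinity> else x * y)"

text \<open>The argument \<open>g\<close> is the absolute value of the function whose norm is taken.\<close>

definition lp_norm :: "real \<Rightarrow> 'a set \<Rightarrow> ('a \<Rightarrow> real) \<Rightarrow> ('a \<Rightarrow> ennreal) \<Rightarrow> ennreal" where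
  "lp_norm p A \<theta> g = (\<Sum>\<^sub>\<infinity>x\<in>A. g x epowr p * ennreal (\<theta> x)) epowr (1 / p)"

definition eta :: "'d::finite config \<Rightarrow> 'd lattice \<Rightarrow> ennreal" where
  "eta \<omega> y = max 1 (ennreal_of_enat (gdist \<omega> 0 y))"

definition energy ::
    "('d::finite config \<Rightarrow> 'd lattice \<Rightarrow> 'd lattice \<Rightarrow> real) \<Rightarrow> 'd config \<Rightarrow> ('d lattice \<Rightarrow> real) \<Rightarrow> ennreal" where
  "energy W \<omega> f = 1/2 * (\<Sum>\<^sub>\<infinity>(x, y)\<in>{(x, y). nbr \<omega> x y}. ennreal (W \<omega> x y * (f y - f x)\<^sup>2))"

end

theory Submission
  imports Defs
begin

text \<open>
  The exponents may be chosen freely, so crude polynomial bounds suffice. Write \<open>S = \<parallel>f\<parallel>\<^sub>2\<^sup>2\<close>, \<open>U = \<parallel>f\<parallel>\<^sub>1\<close> and \<open>T\<close> for the squared weighted norm.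
  As \<open>\<theta>\<close> is bounded below by \<open>c\<close>, one has \<open>S \<le> U\<^sup>2 / c\<close>. At least half of \<open>S\<close> sits in the ball of
  radius \<open>n \<approx> 2 T / S\<close>, whose total mass is polynomial in \<open>n\<close>, so \<open>f(x)\<^sup>2\<close> is polynomially large
  relative to \<open>S\<close> for some \<open>x\<close> in this ball. On a ball whose radius is a larger power of \<open>n\<close> there is
  a point \<open>y\<close> with \<open>\<bar>f(y)\<bar> \<le> \<bar>f(x)\<bar> / 2\<close>, because this ball has at least as many points as its radius.
  The gradient along a path from \<open>x\<close> to \<open>y\<close> through the origin costs energy, and the weights are
  polynomially bounded below, so \<open>S \<le> C E (T / S)\<^sup>A\<close> with \<open>A = 6 d + 2 d\<^sup>2\<close>. Multiplying the two
  bounds gives \<open>S\<^bsup>A + 2\<^esup> \<le> C E U\<^sup>2 T\<^sup>A / c\<close>, that is \<open>\<alpha> = \<beta> = 1 / (A + 2)\<close> and \<open>\<gamma> = A / (A + 2)\<close>.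
\<close>

section \<open>Weighted rooted graphs of polynomial growth\<close>

text \<open>The distance from the root is \<open>\<rho>\<close>; the bounds \<open>\<theta>_le\<close> and \<open>w_le\<close> are what remains of the norm
  bounds on \<open>\<theta>\<close> and \<open>\<nu>\<close>: a value on a ball is at most the sum over the ball.\<close>

locale rooted_graph =
  fixes K :: "'a set" and G :: "'a rel" and \<rho> :: "'a \<Rightarrow> nat" and root :: 'a
    and \<theta> :: "'a \<Rightarrow> real" and w :: "'a \<Rightarrow> 'a \<Rightarrow> real" and c M :: real and d :: nat
  assumes infinite_K: "infinite K"
    and finite_level: "\<And>n. finite {x \<in> K. \<rho> x \<le> n}"
    and card_level: "\<And>n. card {x \<in> K. \<rho> x \<le> n} \<le> (2 * n + 1) ^ d"
    and level_0: "\<And>x. x \<in> K \<Longrightarrow> \<rho> x = 0 \<Longrightarrow> x = root"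
    and level_Suc: "\<And>x j. x \<in> K \<Longrightarrow> \<rho> x = Suc j \<Longrightarrow> \<exists>y\<in>K. \<rho> y = j \<and> (y, x) \<in> G"
    and c_pos: "0 < c" and M_pos: "0 < M" and d_pos: "0 < d"
    and \<theta>_ge: "\<And>x. x \<in> K \<Longrightarrow> c \<le> \<theta> x"
    and \<theta>_le: "\<And>x n. x \<in> K \<Longrightarrow> \<rho> x \<le> n \<Longrightarrow> 1 \<le> n \<Longrightarrow> \<theta> x \<le> M * card {x \<in> K. \<rho> x \<le> n}"
    and w_pos: "\<And>x y. (x, y) \<in> G \<Longrightarrow> 0 < w x y"
    and w_le: "\<And>x y n. (x, y) \<in> G \<Longrightarrow> \<rho> x \<le> n \<Longrightarrow> 1 \<le> n \<Longrightarrow>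
                 inverse (w x y) \<le> M * card {x \<in> K. \<rho> x \<le> n}"
begin

section \<open>Balls around the root and their cardinalities\<close>

definition level_ball :: "nat \<Rightarrow> 'a set" where
  "level_ball n = {x \<in> K. \<rho> x \<le> n}"

lemma finite_level_ball: "finite (level_ball n)"
  using finite_level by (simp add: level_ball_def)

lemma card_level_ball_le:
  assumes "1 \<le> n"
  shows "real (card (level_ball n)) \<le> (3 * real n) ^ d"
proof -
  have "real (card (level_ball n)) \<le> real ((2 * n + 1) ^ d)"
    using card_level[of n] unfolding level_ball_def of_nat_le_iff .
  also have "\<dots> = (2 * real n + 1) ^ d" by (simp add: add.commute)
  also have "\<dots> \<le> (3 * real n) ^ d" using assms by (intro power_mono) auto
  finally show ?thesis .
qed

text \<open>Balls are finite and \<open>K\<close> is infinite, so some point lies beyond level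
  \<open>n\<close>; \<open>level_Suc\<close> then descends one level at a time until level
  \<open>n\<close> is reached.\<close>

lemma level_nonempty: "\<exists>x\<in>K. \<rho> x = n"
proof -
  have "\<exists>x\<in>K. \<rho> x > n"
  proof (rule ccontr)
    assume "\<not> ?thesis"
    then have "K \<subseteq> {x \<in> K. \<rho> x \<le> n}" by (auto simp: not_less)
    then show False using infinite_K finite_level finite_subset by blast
  qed
  then obtain x where x: "x \<in> K" "\<rho> x > n" by blast
  have "\<exists>y\<in>K. \<rho> y = n" if "x \<in> K" "\<rho> x = n + k" for x k
    using that
  proof (induction k arbitrary: x)
    case (Suc k)
    then show ?case using level_Suc[of x "n + k"] by fastforce
  qed auto
  from this[of x "\<rho> x - n"] x show ?thesis by simp
qed

text \<open>Each of the \<open>n + 1\<close> levels up to \<open>n\<close> contributes a point. This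
  linear lower bound on the volume is what forces small values of \<open>f\<close> on large
  balls.\<close>

lemma le_card_level_ball: "n < card (level_ball n)"
proof -
  have "{..n} \<subseteq> \<rho> ` level_ball n"
  proof
    fix j assume "j \<in> {..n}"
    then show "j \<in> \<rho> ` level_ball n"
      using level_nonempty[of j] by (force simp: level_ball_def)
  qed
  then have "card {..n} \<le> card (\<rho> ` level_ball n)"
    by (intro card_mono finite_imageI finite_level_ball)
  also have "\<dots> \<le> card (level_ball n)" by (rule card_image_le[OF finite_level_ball])
  finally show ?thesis by simp
qed

lemma level_ball_nonempty: "level_ball n \<noteq> {}"
  using le_card_level_ball[of n] by auto

section \<open>Oscillation, concentration and energy at a fixed scale\<close>

text \<open>Telescoping along a path that descends to the root. An edge costs at most the square
  root of its energy divided by its weight, and \<open>w_le\<close> at the endpoint closer to the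
  root controls the inverse weight.\<close>

lemma diff_root_le:
  fixes f :: "'a \<Rightarrow> real"
  assumes E: "\<And>x y. (x, y) \<in> G \<Longrightarrow> w x y * (f y - f x)\<^sup>2 \<le> 2 * E"
    and k: "1 \<le> k" and x: "x \<in> level_ball k"
  shows "\<bar>f x - f root\<bar> \<le> k * sqrt (2 * E * (M * card (level_ball k)))"
proof -
  define D where "D = sqrt (2 * E * (M * card (level_ball k)))"
  have edge: "\<bar>f v - f u\<bar> \<le> D" if uv: "(u, v) \<in> G" "\<rho> u \<le> k" for u v
  proof -
    have wp: "0 < w u v" using w_pos uv by blast
    have "0 \<le> w u v * (f v - f u)\<^sup>2" using wp by simp
    then have E0: "0 \<le> 2 * E" using E[OF uv(1)] by linarith
    have "(f v - f u)\<^sup>2 = (w u v * (f v - f u)\<^sup>2) * inverse (w u v)"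
      using wp by (simp add: field_simps)
    also have "\<dots> \<le> 2 * E * (M * card (level_ball k))"
      using E[OF uv(1)] w_le[OF uv k] wp E0 unfolding level_ball_def
      by (intro mult_mono[of "w u v * (f v - f u)\<^sup>2"]) auto
    finally show ?thesis unfolding D_def by (intro real_le_rsqrt) simp
  qed
  \<comment> \<open>The sign of \<open>E\<close> is not assumed, and \<open>sqrt\<close> of a
    negative number is negative. An edge from level 0 to level 1 settles the sign, since
    \<open>D\<close> bounds an absolute value there.\<close>
  have D0: "0 \<le> D"
  proof -
    obtain z where z: "z \<in> K" "\<rho> z = Suc 0" using level_nonempty by blast
    obtain u where "\<rho> u = 0" "(u, z) \<in> G" using level_Suc[OF z] by blast
    then show ?thesis using edge[of u z] by linarith
  qed
  have "\<bar>f x - f root\<bar> \<le> j * D" if "x \<in> K" "\<rho> x = j" "j \<le> k" for x j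
    using that
  proof (induction j arbitrary: x)
    case 0
    then show ?case using level_0[of x] by simp
  next
    case (Suc j)
    obtain y where y: "y \<in> K" "\<rho> y = j" "(y, x) \<in> G" using level_Suc Suc.prems by blast
    have "\<bar>f y - f root\<bar> \<le> j * D" using Suc.IH[of y] y Suc.prems by simp
    moreover have "\<bar>f x - f y\<bar> \<le> D" using edge y Suc.prems by simp
    ultimately show ?case by (simp add: algebra_simps)
  qed
  from this[of x "\<rho> x"] x have "\<bar>f x - f root\<bar> \<le> \<rho> x * D" "\<rho> x \<le> k"
    by (auto simp: level_ball_def)
  moreover have "\<rho> x * D \<le> k * D" using D0 \<open>\<rho> x \<le> k\<close> by (intro mult_right_mono) auto
  ultimately show ?thesis unfolding D_def by linarith
qed

text \<open>Chebyshev's argument: outside the ball the weight is at least \<open>n\<close>, so the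
  tail is at most \<open>T / n\<close>, which is at most \<open>S / 2\<close>. The assumptions on
  \<open>S\<close> and \<open>T\<close> speak of finite partial sums only: \<open>S\<close> lies
  below each of their upper bounds, and \<open>T\<close> is one for the weighted sums.\<close>

lemma concentration:
  fixes f :: "'a \<Rightarrow> real"
  assumes m: "1 \<le> m" and n: "1 \<le> n" "2 * T \<le> n * S"
    and S: "\<And>b. (\<And>F. finite F \<Longrightarrow> F \<subseteq> K \<Longrightarrow> (\<Sum>x\<in>F. \<theta> x * (f x)\<^sup>2) \<le> b) \<Longrightarrow> S \<le> b"
    and T: "\<And>F. finite F \<Longrightarrow> F \<subseteq> K \<Longrightarrow>
              (\<Sum>x\<in>F. \<theta> x * (max 1 (real (\<rho> x)) powr m * (f x)\<^sup>2)) \<le> T"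
  shows "S \<le> 2 * (\<Sum>x\<in>level_ball n. \<theta> x * (f x)\<^sup>2)"
proof -
  have \<theta>0: "0 \<le> \<theta> x" if "x \<in> K" for x using \<theta>_ge[OF that] c_pos by simp
  have "S \<le> (\<Sum>x\<in>level_ball n. \<theta> x * (f x)\<^sup>2) + T / n"
  proof (rule S)
    fix F assume F: "finite F" "F \<subseteq> K"
    have "n * (\<Sum>x\<in>F - level_ball n. \<theta> x * (f x)\<^sup>2)
        \<le> (\<Sum>x\<in>F - level_ball n. \<theta> x * (max 1 (real (\<rho> x)) powr m * (f x)\<^sup>2))"
      unfolding sum_distrib_left
    proof (rule sum_mono)
      fix x assume "x \<in> F - level_ball n"
      then have x: "x \<in> K" "n \<le> \<rho> x" using F by (auto simp: level_ball_def)
      have "real n \<le> max 1 (real (\<rho> x))" using x by simp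
      also have "\<dots> \<le> max 1 (real (\<rho> x)) powr m"
        using powr_mono[OF m, of "max 1 (real (\<rho> x))"] by simp
      finally have "real n * (\<theta> x * (f x)\<^sup>2) \<le> max 1 (real (\<rho> x)) powr m * (\<theta> x * (f x)\<^sup>2)"
        using \<theta>0 x by (intro mult_right_mono) auto
      then show "real n * (\<theta> x * (f x)\<^sup>2) \<le> \<theta> x * (max 1 (real (\<rho> x)) powr m * (f x)\<^sup>2)"
        by (simp add: algebra_simps)
    qed
    also have "\<dots> \<le> T" using F by (intro T) auto
    finally have 1: "(\<Sum>x\<in>F - level_ball n. \<theta> x * (f x)\<^sup>2) \<le> T / n"
      using n by (simp add: field_simps)
    have 2: "(\<Sum>x\<in>F \<inter> level_ball n. \<theta> x * (f x)\<^sup>2) \<le> (\<Sum>x\<in>level_ball n. \<theta> x * (f x)\<^sup>2)"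
      using finite_level_ball \<theta>0 by (intro sum_mono2) (auto simp: level_ball_def)
    show "(\<Sum>x\<in>F. \<theta> x * (f x)\<^sup>2) \<le> (\<Sum>x\<in>level_ball n. \<theta> x * (f x)\<^sup>2) + T / n"
      using 1 2 sum.Int_Diff[OF F(1), of "\<lambda>x. \<theta> x * (f x)\<^sup>2" "level_ball n"] by linarith
  qed
  moreover have "T / n \<le> S / 2" using n by (simp add: field_simps)
  ultimately show ?thesis by linarith
qed

text \<open>Compares a maximum point \<open>x0\<close> of \<open>f\<^sup>2\<close> on the small ball
  with a minimum point \<open>y\<close> on the large one. The condition on \<open>k\<close> makes
  \<open>f\<close> at least halve in absolute value from \<open>x0\<close> to \<open>y\<close>, and
  \<open>diff_root_le\<close> turns this drop into energy.\<close>

lemma energy_at_scale: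
  fixes f :: "'a \<Rightarrow> real"
  assumes m: "1 \<le> m" and n: "1 \<le> n" "2 * T \<le> n * S"
    and S: "\<And>b. (\<And>F. finite F \<Longrightarrow> F \<subseteq> K \<Longrightarrow> (\<Sum>x\<in>F. \<theta> x * (f x)\<^sup>2) \<le> b) \<Longrightarrow> S \<le> b"
    and S': "\<And>F. finite F \<Longrightarrow> F \<subseteq> K \<Longrightarrow> (\<Sum>x\<in>F. \<theta> x * (f x)\<^sup>2) \<le> S"
    and T: "\<And>F. finite F \<Longrightarrow> F \<subseteq> K \<Longrightarrow>
              (\<Sum>x\<in>F. \<theta> x * (max 1 (real (\<rho> x)) powr m * (f x)\<^sup>2)) \<le> T"
    and E: "\<And>x y. (x, y) \<in> G \<Longrightarrow> w x y * (f y - f x)\<^sup>2 \<le> 2 * E" "0 \<le> E"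
    and k: "n \<le> k" "8 * M * (real (card (level_ball n)))\<^sup>2 \<le> c * k"
  shows "S \<le> 64 * M\<^sup>2 * E * (real (card (level_ball n)))\<^sup>2 * (real k)\<^sup>2 * card (level_ball k)"
proof -
  let ?L = "real (card (level_ball n))" and ?b = "real (card (level_ball k))"
  let ?g = "\<lambda>x. (f x)\<^sup>2"
  obtain x0 where x0: "x0 \<in> level_ball n" "\<And>x. x \<in> level_ball n \<Longrightarrow> ?g x \<le> ?g x0"
  proof -
    have "Max (?g ` level_ball n) \<in> ?g ` level_ball n"
      using finite_level_ball level_ball_nonempty by (intro Max_in) auto
    then obtain x0 where "x0 \<in> level_ball n" "Max (?g ` level_ball n) = ?g x0" by blast
    then show ?thesis using that[of x0] Max_ge[of "?g ` level_ball n"] finite_level_ball by auto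
  qed
  obtain y where y: "y \<in> level_ball k" "\<And>x. x \<in> level_ball k \<Longrightarrow> ?g y \<le> ?g x"
  proof -
    have "Min (?g ` level_ball k) \<in> ?g ` level_ball k"
      using finite_level_ball level_ball_nonempty by (intro Min_in) auto
    then obtain y where "y \<in> level_ball k" "Min (?g ` level_ball k) = ?g y" by blast
    then show ?thesis using that[of y] Min_le[of "?g ` level_ball k"] finite_level_ball by auto
  qed
  have "(\<Sum>x\<in>level_ball n. \<theta> x * ?g x) \<le> (\<Sum>x\<in>level_ball n. M * ?L * ?g x0)"
  proof (rule sum_mono)
    fix x assume x: "x \<in> level_ball n"
    then have "\<theta> x \<le> M * ?L" using \<theta>_le[of x n] n unfolding level_ball_def by simp
    then show "\<theta> x * ?g x \<le> M * ?L * ?g x0" using x0(2)[OF x] M_pos by (intro mult_mono) auto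
  qed
  \<comment> \<open>One factor \<open>?L\<close> comes from the bound on \<open>\<theta>\<close>,
    the other from the number of summands.\<close>
  then have Sx0: "S \<le> 2 * M * ?L\<^sup>2 * ?g x0"
    using concentration[OF m n S T] by (simp add: power2_eq_square algebra_simps)
  \<comment> \<open>The large ball has more than \<open>k\<close> points, and each carries mass at
    least \<open>c\<close> and a value of \<open>f\<^sup>2\<close> at least that at
    \<open>y\<close>.\<close>
  have "k * (c * ?g y) \<le> ?b * (c * ?g y)"
    using le_card_level_ball[of k] c_pos by (intro mult_right_mono) auto
  also have "\<dots> = (\<Sum>x\<in>level_ball k. c * ?g y)" by simp
  also have "\<dots> \<le> (\<Sum>x\<in>level_ball k. \<theta> x * ?g x)"
  proof (rule sum_mono)
    fix x assume x: "x \<in> level_ball k"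
    then have "c \<le> \<theta> x" using \<theta>_ge by (simp add: level_ball_def)
    then show "c * ?g y \<le> \<theta> x * ?g x" using y(2)[OF x] c_pos by (intro mult_mono) auto
  qed
  also have "\<dots> \<le> S" by (intro S' finite_level_ball) (auto simp: level_ball_def)
  finally have "c * k * ?g y \<le> 2 * M * ?L\<^sup>2 * ?g x0" using Sx0 by (simp add: algebra_simps)
  \<comment> \<open>The constant 8 in the condition on \<open>k\<close> is 2 from \<open>Sx0\<close>
    times the 4 needed to halve \<open>f\<close> after taking roots.\<close>
  moreover have "8 * M * ?L\<^sup>2 * ?g y \<le> c * k * ?g y" using k(2) by (intro mult_right_mono) auto
  ultimately have "(2 * M * ?L\<^sup>2) * (4 * ?g y) \<le> (2 * M * ?L\<^sup>2) * ?g x0" by (simp add: algebra_simps)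
  moreover have "0 < 2 * M * ?L\<^sup>2" using M_pos le_card_level_ball[of n] by simp
  ultimately have "4 * ?g y \<le> ?g x0" by (simp only: mult_le_cancel_left_pos)
  then have "(2 * f y)\<^sup>2 \<le> (f x0)\<^sup>2" by (simp add: power_mult_distrib)
  then have fy: "2 * \<bar>f y\<bar> \<le> \<bar>f x0\<bar>" by (simp only: abs_le_square_iff[symmetric] abs_mult abs_numeral)
  have k1: "1 \<le> k" using n k by simp
  define D where "D = sqrt (2 * E * (M * ?b))"
  have "x0 \<in> level_ball k" using x0(1) k(1) by (auto simp: level_ball_def)
  then have "\<bar>f x0 - f root\<bar> \<le> k * D" "\<bar>f y - f root\<bar> \<le> k * D"
    using diff_root_le[OF E(1) k1] y(1) unfolding D_def by blast+
  \<comment> \<open>Passing through the root, \<open>f\<close> changes by at most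
    \<open>2 * k * D\<close> between \<open>x0\<close> and \<open>y\<close>, and at least half of
    \<open>\<bar>f x0\<bar>\<close> is lost.\<close>
  then have "\<bar>f x0\<bar> \<le> 4 * k * D" using fy by linarith
  then have "\<bar>f x0\<bar>\<^sup>2 \<le> (4 * k * D)\<^sup>2" by (intro power_mono) auto
  moreover have "D\<^sup>2 = 2 * E * (M * ?b)" using E(2) M_pos by (simp add: D_def)
  ultimately have "?g x0 \<le> 16 * (real k)\<^sup>2 * (2 * E * (M * ?b))"
    by (simp add: power_mult_distrib)
  then have "2 * M * ?L\<^sup>2 * ?g x0 \<le> 2 * M * ?L\<^sup>2 * (16 * (real k)\<^sup>2 * (2 * E * (M * ?b)))"
    using M_pos by (intro mult_left_mono) auto
  with Sx0 show ?thesis by (simp add: power2_eq_square algebra_simps)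
qed

text \<open>The factor \<open>64 * M\<^sup>2\<close> comes from the estimate at fixed scale,
  \<open>3 ^ (3 * d)\<close> from the volumes of both balls, the bracket from bounding
  \<open>k\<close> by a multiple of \<open>n ^ (2 * d)\<close>, and the last power from
  \<open>n\<close> being at most \<open>3 * (T / S)\<close>.\<close>

definition energy_const :: real where
  "energy_const = 64 * M\<^sup>2 * 3 ^ (3 * d) * (2 + 8 * M * 3 ^ (2 * d) / c) ^ (d + 2) * 3 ^ (6 * d + 2 * d\<^sup>2)"

lemma energy_const_pos: "0 < energy_const"
  using M_pos c_pos by (simp add: energy_const_def add_pos_nonneg)

text \<open>Takes the least radii suggested by \<open>energy_at_scale\<close>, up to rounding, and
  bounds them by powers of \<open>T / S\<close>. The exponent is \<open>2 * d\<close> from the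
  squared small volume plus \<open>2 * d * (d + 2)\<close> from \<open>k ^ (d + 2)\<close>.\<close>

lemma energy_lower_bound:
  fixes f :: "'a \<Rightarrow> real"
  assumes m: "1 \<le> m" and S0: "0 < S"
    and S: "\<And>b. (\<And>F. finite F \<Longrightarrow> F \<subseteq> K \<Longrightarrow> (\<Sum>x\<in>F. \<theta> x * (f x)\<^sup>2) \<le> b) \<Longrightarrow> S \<le> b"
    and S': "\<And>F. finite F \<Longrightarrow> F \<subseteq> K \<Longrightarrow> (\<Sum>x\<in>F. \<theta> x * (f x)\<^sup>2) \<le> S"
    and T: "\<And>F. finite F \<Longrightarrow> F \<subseteq> K \<Longrightarrow>
              (\<Sum>x\<in>F. \<theta> x * (max 1 (real (\<rho> x)) powr m * (f x)\<^sup>2)) \<le> T"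
    and E: "\<And>x y. (x, y) \<in> G \<Longrightarrow> w x y * (f y - f x)\<^sup>2 \<le> 2 * E" and E0: "0 \<le> E"
  shows "S \<le> energy_const * E * (T / S) ^ (6 * d + 2 * d\<^sup>2)"
proof -
  define Q where "Q = 2 + 8 * M * 3 ^ (2 * d) / c"
  define C0 where "C0 = 64 * M\<^sup>2 * 3 ^ (3 * d) * Q ^ (d + 2)"
  define A where "A = 6 * d + 2 * d\<^sup>2"
  have Q0: "0 < Q" using M_pos c_pos by (simp add: Q_def add_pos_nonneg)
  have C0: "0 < C0" using Q0 M_pos by (simp add: C0_def)
  \<comment> \<open>The weight is at least 1. Hence \<open>T / S\<close> is at least 1, and rounding
    \<open>2 * (T / S)\<close> up gives at most \<open>3 * (T / S)\<close>.\<close>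
  have "S \<le> T"
  proof (rule S)
    fix F assume F: "finite F" "F \<subseteq> K"
    have "(\<Sum>x\<in>F. \<theta> x * (f x)\<^sup>2) \<le> (\<Sum>x\<in>F. \<theta> x * (max 1 (real (\<rho> x)) powr m * (f x)\<^sup>2))"
    proof (rule sum_mono)
      fix x assume "x \<in> F"
      then have "0 \<le> \<theta> x" using \<theta>_ge[of x] c_pos F by force
      moreover have "1 \<le> max 1 (real (\<rho> x)) powr m" using m by (intro ge_one_powr_ge_zero) auto
      then have "1 * (f x)\<^sup>2 \<le> max 1 (real (\<rho> x)) powr m * (f x)\<^sup>2"
        by (intro mult_right_mono) auto
      ultimately show "\<theta> x * (f x)\<^sup>2 \<le> \<theta> x * (max 1 (real (\<rho> x)) powr m * (f x)\<^sup>2)"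
        by (intro mult_left_mono) auto
    qed
    with T[OF F] show "(\<Sum>x\<in>F. \<theta> x * (f x)\<^sup>2) \<le> T" by linarith
  qed
  then have TS: "1 \<le> T / S" using S0 by simp
  define n where "n = nat \<lceil>2 * (T / S)\<rceil>"
  have n_ge: "2 * (T / S) \<le> real n" unfolding n_def by linarith
  have n_le: "real n \<le> 3 * (T / S)" using TS unfolding n_def by linarith
  have n1: "1 \<le> n" using n_ge TS by linarith
  have n2: "2 * T \<le> n * S" using n_ge S0 by (simp add: field_simps)
  let ?L = "real (card (level_ball n))"
  define k where "k = n + nat \<lceil>8 * M * ?L\<^sup>2 / c\<rceil>"
  have L: "?L \<le> (3 * real n) ^ d" by (rule card_level_ball_le[OF n1])
  then have L2: "?L\<^sup>2 \<le> ((3 * real n) ^ d)\<^sup>2" by (intro power_mono) auto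
  have L2': "((3 * real n) ^ d)\<^sup>2 = 3 ^ (2 * d) * real n ^ (2 * d)"
    by (simp add: power_mult_distrib power_mult[symmetric] mult.commute)
  have kn: "n \<le> k" by (simp add: k_def)
  have k_real: "8 * M * ?L\<^sup>2 / c \<le> k" unfolding k_def by linarith
  have kc: "8 * M * ?L\<^sup>2 \<le> c * k" using k_real c_pos by (simp add: field_simps)
  have "real n ^ 1 \<le> real n ^ (2 * d)" using n1 d_pos by (intro power_increasing) auto
  moreover have "1 \<le> real n ^ (2 * d)" using n1 by simp
  moreover have "8 * M * ?L\<^sup>2 / c \<le> 8 * M * (3 ^ (2 * d) * real n ^ (2 * d)) / c"
    using L2 M_pos c_pos unfolding L2' by (intro divide_right_mono mult_left_mono) auto
  moreover have "0 \<le> 8 * M * ?L\<^sup>2 / c" using M_pos c_pos by simp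
  then have "real k \<le> n + 8 * M * ?L\<^sup>2 / c + 1" unfolding k_def by linarith
  moreover have "Q * real n ^ (2 * d)
      = 2 * real n ^ (2 * d) + 8 * M * (3 ^ (2 * d) * real n ^ (2 * d)) / c"
    by (simp add: Q_def algebra_simps)
  \<comment> \<open>The summand \<open>n\<close> and the 1 lost to rounding are each at most
    \<open>n ^ (2 * d)\<close>; this is the 2 in \<open>Q\<close>.\<close>
  ultimately have k_le: "real k \<le> Q * real n ^ (2 * d)" unfolding power_one_right by linarith
  have "real (card (level_ball k)) \<le> (3 * real k) ^ d"
    using kn n1 by (intro card_level_ball_le) simp
  then have b: "(real k)\<^sup>2 * real (card (level_ball k)) \<le> 3 ^ d * real k ^ (d + 2)"
    using mult_left_mono[of "real (card (level_ball k))" "(3 * real k) ^ d" "(real k)\<^sup>2"]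
    by (simp add: power_mult_distrib power_add algebra_simps power2_eq_square)
  have "real k ^ (d + 2) \<le> (Q * real n ^ (2 * d)) ^ (d + 2)" using k_le by (intro power_mono) auto
  then have "3 ^ d * real k ^ (d + 2) \<le> 3 ^ d * (Q * real n ^ (2 * d)) ^ (d + 2)"
    by (intro mult_left_mono) auto
  with b have b': "(real k)\<^sup>2 * real (card (level_ball k)) \<le> 3 ^ d * (Q * real n ^ (2 * d)) ^ (d + 2)"
    by linarith
  have "S \<le> 64 * M\<^sup>2 * E * ?L\<^sup>2 * (real k)\<^sup>2 * card (level_ball k)"
    using energy_at_scale[OF m n1 n2 S S' T E E0 kn kc] by simp
  also have "\<dots> = (64 * M\<^sup>2 * E) * (?L\<^sup>2 * ((real k)\<^sup>2 * card (level_ball k)))" by simp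
  also have "\<dots> \<le> (64 * M\<^sup>2 * E) * ((3 ^ (2 * d) * real n ^ (2 * d))
                    * (3 ^ d * (Q * real n ^ (2 * d)) ^ (d + 2)))"
    using E0 by (intro mult_left_mono mult_mono[OF L2[unfolded L2'] b']) auto
  also have "\<dots> = C0 * E * (real n ^ (2 * d) * (real n ^ (2 * d)) ^ (d + 2))"
    by (simp add: C0_def power_mult_distrib power_add[symmetric] algebra_simps)
  also have "real n ^ (2 * d) * (real n ^ (2 * d)) ^ (d + 2) = real n ^ A"
    by (simp add: A_def power_add[symmetric] power_mult[symmetric] algebra_simps power2_eq_square)
  also have "C0 * E * real n ^ A \<le> C0 * E * (3 * (T / S)) ^ A"
    using n_le C0 E0 by (intro mult_left_mono power_mono) auto
  finally have "S \<le> (C0 * 3 ^ A) * E * (T / S) ^ A"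
    unfolding power_mult_distrib by (simp only: mult_ac)
  then show ?thesis unfolding energy_const_def C0_def Q_def A_def .
qed

text \<open>A single term of the weighted l1 sum is at most \<open>U\<close>, so
  \<open>\<bar>f x\<bar>\<close> is at most \<open>U / c\<close> everywhere; one factor of the
  square is replaced by this bound.\<close>

lemma l2_le_l1:
  fixes f :: "'a \<Rightarrow> real"
  assumes F: "finite F" "F \<subseteq> K"
    and U: "\<And>F. finite F \<Longrightarrow> F \<subseteq> K \<Longrightarrow> (\<Sum>x\<in>F. \<theta> x * \<bar>f x\<bar>) \<le> U"
  shows "(\<Sum>x\<in>F. \<theta> x * (f x)\<^sup>2) \<le> U\<^sup>2 / c"
proof -
  have U0: "0 \<le> U" using U[of "{}"] by simp
  have "(\<Sum>x\<in>F. \<theta> x * (f x)\<^sup>2) \<le> (\<Sum>x\<in>F. (\<theta> x * \<bar>f x\<bar>) * (U / c))"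
  proof (rule sum_mono)
    fix x assume "x \<in> F"
    then have x: "x \<in> K" using F by auto
    have "c * \<bar>f x\<bar> \<le> \<theta> x * \<bar>f x\<bar>" using \<theta>_ge[OF x] by (intro mult_right_mono) auto
    also have "\<dots> \<le> U" using U[of "{x}"] x by simp
    finally have "\<bar>f x\<bar> \<le> U / c" using c_pos by (simp add: field_simps)
    then have "(\<theta> x * \<bar>f x\<bar>) * \<bar>f x\<bar> \<le> (\<theta> x * \<bar>f x\<bar>) * (U / c)"
      using \<theta>_ge[OF x] c_pos by (intro mult_left_mono) auto
    then show "\<theta> x * (f x)\<^sup>2 \<le> (\<theta> x * \<bar>f x\<bar>) * (U / c)"
      by (simp add: power2_eq_square mult.assoc)
  qed
  also have "\<dots> = (\<Sum>x\<in>F. \<theta> x * \<bar>f x\<bar>) * (U / c)" by (rule sum_distrib_right[symmetric])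
  also have "\<dots> \<le> U * (U / c)" using U[OF F] U0 c_pos by (intro mult_right_mono) auto
  finally show ?thesis by (simp add: power2_eq_square)
qed

end

section \<open>The infinite cluster as a rooted graph\<close>

text \<open>One term is at most the whole sum, and undoing the average costs the factor
  \<open>card A powr (1 / p)\<close>, at most \<open>card A\<close>. For infinite \<open>p\<close>
  the maximum is already a bound and \<open>card A\<close> is at least 1.\<close>

lemma avg_norm_bound:
  assumes p: "1 < p" and A: "finite A" "x \<in> A" and M: "avg_norm p A g \<le> M"
  shows "\<bar>g x\<bar> \<le> M * card A"
proof -
  have N: "1 \<le> real (card A)" using A card_gt_0_iff[of A] by (auto simp: Suc_le_eq)
  show ?thesis
  proof (cases "p = \<infinity>")
    case True
    have "\<bar>g x\<bar> \<le> avg_norm p A g" using True A by (simp add: avg_norm_def)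
    then have "\<bar>g x\<bar> \<le> M" using M by simp
    moreover from this N have "M * 1 \<le> M * card A" by (intro mult_left_mono) auto
    ultimately show ?thesis by simp
  next
    case False
    define r where "r = enn2real p"
    have "p = ennreal r" using False by (simp add: r_def less_top)
    then have "1 < r" using p ennreal_less_iff[of 1 r] by simp
    then have r: "1 \<le> r" by simp
    let ?s = "\<Sum>x\<in>A. \<bar>g x\<bar> powr r"
    have "\<bar>g x\<bar> powr r \<le> ?s"
      using A by (intro member_le_sum) auto
    then have "(\<bar>g x\<bar> powr r) powr (1 / r) \<le> ?s powr (1 / r)"
      using r by (intro powr_mono2) auto
    then have "\<bar>g x\<bar> \<le> ?s powr (1 / r)" using r by (simp add: powr_powr)
    also have "?s = (1 / card A * ?s) * card A" using N by simp
    also have "\<dots> powr (1 / r) = (1 / card A * ?s) powr (1 / r) * card A powr (1 / r)"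
      by (rule powr_mult)
    also have "(1 / card A * ?s) powr (1 / r) = avg_norm p A g"
      using False by (simp add: avg_norm_def r_def)
    also have "avg_norm p A g * card A powr (1 / r) \<le> M * card A"
    proof (intro mult_mono M)
      have "card A powr (1 / r) \<le> card A powr 1" using N r by (intro powr_mono) auto
      then show "card A powr (1 / r) \<le> card A" using N by simp
      show "0 \<le> M" using M False by (auto simp: avg_norm_def intro: order_trans[rotated])
    qed auto
    finally show ?thesis .
  qed
qed

lemma avg_norm_nonneg:
  assumes "finite A" "x \<in> A"
  shows "0 \<le> avg_norm p A g"
proof (cases "p = \<infinity>")
  case True
  have "0 \<le> \<bar>g x\<bar>" by simp
  also have "\<dots> \<le> (MAX x\<in>A. \<bar>g x\<bar>)" using assms by (intro Max_ge) auto
  finally show ?thesis using True by (simp add: avg_norm_def)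
qed (simp add: avg_norm_def)

lemma infsum_ennreal_le_iff:
  fixes f :: "'a \<Rightarrow> ennreal"
  shows "infsum f A \<le> b \<longleftrightarrow> (\<forall>F. finite F \<and> F \<subseteq> A \<longrightarrow> sum f F \<le> b)"
proof safe
  fix F assume F: "finite F" "F \<subseteq> A" and "infsum f A \<le> b"
  have "sum f F = infsum f F" using F by simp
  also have "\<dots> \<le> infsum f A" using F
    by (intro infsum_mono_neutral nonneg_summable_on_complete) auto
  also have "\<dots> \<le> b" by fact
  finally show "sum f F \<le> b" .
next
  assume *: "\<forall>F. finite F \<and> F \<subseteq> A \<longrightarrow> sum f F \<le> b"
  have "infsum f A = (SUP F\<in>{F. finite F \<and> F \<subseteq> A}. sum f F)"
    by (rule nonneg_infsum_complete) simp
  also have "\<dots> \<le> b" using * by (intro SUP_least) auto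
  finally show "infsum f A \<le> b" .
qed

text \<open>Used in both directions, this turns a finite infinite sum into the upper bound and least
  upper bound assumptions of the abstract estimates. For negative \<open>b\<close> both sides fail,
  the right one because of the empty sum.\<close>

lemma infsum_ennreal_real_iff:
  fixes g :: "'a \<Rightarrow> real"
  assumes "infsum f A = ennreal s" "0 \<le> s"
    and "\<And>x. x \<in> A \<Longrightarrow> f x = ennreal (g x)" "\<And>x. x \<in> A \<Longrightarrow> 0 \<le> g x"
  shows "s \<le> b \<longleftrightarrow> (\<forall>F. finite F \<and> F \<subseteq> A \<longrightarrow> sum g F \<le> b)"
proof (cases "0 \<le> b")
  case True
  have "sum f F = ennreal (sum g F)" if "finite F" "F \<subseteq> A" for F
    using that assms(3,4) by (subst sum_ennreal[symmetric]) (auto intro!: sum.cong)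
  then show ?thesis
    using infsum_ennreal_le_iff[of f A "ennreal b"] True assms(1,2) by (auto simp: ennreal_le_iff)
next
  case False
  then have "\<exists>F. finite F \<and> F \<subseteq> A \<and> \<not> sum g F \<le> b" by (intro exI[of _ "{}"]) auto
  then show ?thesis using False assms(2) by auto
qed

section \<open>Lattice boxes and the graph distance\<close>

lemma lattice_edges_coord:
  assumes "{x, y} \<in> lattice_edges"
  shows "\<bar>x $ i - y $ i\<bar> \<le> 1" and "x \<noteq> y"
proof -
  obtain a b where ab: "{x, y} = {a, b}" "(\<Sum>i\<in>UNIV. \<bar>a $ i - b $ i\<bar>) = 1"
    using assms unfolding lattice_edges_def by auto
  then have *: "(\<Sum>i\<in>UNIV. \<bar>x $ i - y $ i\<bar>) = 1"
    by (auto simp: doubleton_eq_iff abs_minus_commute)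
  have "\<bar>x $ i - y $ i\<bar> \<le> (\<Sum>i\<in>UNIV. \<bar>x $ i - y $ i\<bar>)" by (intro member_le_sum) auto
  with * show "\<bar>x $ i - y $ i\<bar> \<le> 1" by simp
  from * show "x \<noteq> y" by auto
qed

text \<open>Reading vectors as functions embeds the box into a product of intervals with
  \<open>2 * n + 1\<close> integers each.\<close>

lemma box_card:
  fixes x :: "'d::finite lattice"
  shows "finite {z. \<forall>i. \<bar>z $ i - x $ i\<bar> \<le> int n}"
    and "card {z. \<forall>i. \<bar>z $ i - x $ i\<bar> \<le> int n} \<le> (2 * n + 1) ^ CARD('d)"
proof -
  let ?B = "{z. \<forall>i. \<bar>z $ i - x $ i\<bar> \<le> int n}"
  let ?P = "PiE UNIV (\<lambda>i. {x $ i - int n .. x $ i + int n})"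
  have inj: "inj_on ($) ?B" by (auto simp: inj_on_def vec_eq_iff)
  have sub: "($) ` ?B \<subseteq> ?P" by (auto simp: abs_le_iff algebra_simps)
  have fin: "finite ?P" by (intro finite_PiE) auto
  have "card ?P = (\<Prod>i\<in>UNIV. card {x $ i - int n .. x $ i + int n})"
    by (rule card_PiE) simp
  also have "\<dots> = (\<Prod>i\<in>(UNIV::'d set). 2 * n + 1)" by (intro prod.cong) (auto simp: nat_eq_iff)
  finally have c: "card ?P = (2 * n + 1) ^ CARD('d)" by simp
  show "finite ?B" using finite_imageD[OF finite_subset[OF sub fin] inj] .
  show "card ?B \<le> (2 * n + 1) ^ CARD('d)"
    using card_inj_on_le[OF inj sub fin] c by simp
qed

lemma cluster_adj_relpow_coord:
  "(x, y) \<in> cluster_adj \<omega> ^^ n \<Longrightarrow> \<bar>y $ i - x $ i\<bar> \<le> int n"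
proof (induction n arbitrary: y)
  case (Suc n)
  then obtain z where z: "(x, z) \<in> cluster_adj \<omega> ^^ n" "(z, y) \<in> cluster_adj \<omega>" by auto
  then have "{z, y} \<in> lattice_edges" by (auto simp: cluster_adj_def open_edges_def)
  then have "\<bar>z $ i - y $ i\<bar> \<le> 1" by (rule lattice_edges_coord)
  with Suc.IH[OF z(1)] show ?case by simp
qed simp

lemma gdist_le: "(x, y) \<in> cluster_adj \<omega> ^^ n \<Longrightarrow> gdist \<omega> x y \<le> enat n"
  unfolding gdist_def by (rule INF_lower) simp

text \<open>\<open>enat\<close> is well-ordered, so a nonempty infimum is attained; the empty
  infimum is infinite.\<close>

lemma gdist_eq_enatD: "gdist \<omega> x y = enat n \<Longrightarrow> (x, y) \<in> cluster_adj \<omega> ^^ n"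
proof -
  assume n: "gdist \<omega> x y = enat n"
  let ?S = "enat ` {n. (x, y) \<in> cluster_adj \<omega> ^^ n}"
  have "?S \<noteq> {}"
  proof
    assume "?S = {}"
    then have "gdist \<omega> x y = Inf {}" by (simp only: gdist_def)
    with n show False by (simp add: top_enat_def)
  qed
  then have "Inf ?S \<in> ?S" by (meson all_not_in_conv wellorder_InfI)
  then show ?thesis using n unfolding gdist_def by auto
qed

text \<open>Adjacent points are at distance at most 1, and not at distance 0 because lattice edges
  have distinct endpoints.\<close>

lemma nbr_iff: "nbr \<omega> x y \<longleftrightarrow> (x, y) \<in> cluster_adj \<omega>"
proof
  assume "nbr \<omega> x y"
  then have "gdist \<omega> x y = enat 1" by (simp add: nbr_def one_enat_def)
  from gdist_eq_enatD[OF this] show "(x, y) \<in> cluster_adj \<omega>" by simp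
next
  assume a: "(x, y) \<in> cluster_adj \<omega>"
  then have "gdist \<omega> x y \<le> enat 1" by (intro gdist_le) simp
  then obtain k where k: "gdist \<omega> x y = enat k" "k \<le> 1" by (cases "gdist \<omega> x y") auto
  have "x \<noteq> y" using a lattice_edges_coord(2) by (auto simp: cluster_adj_def open_edges_def)
  with gdist_eq_enatD[OF k(1)] have "k \<noteq> 0" by (auto intro: ccontr)
  with k have "gdist \<omega> x y = 1" by (simp add: one_enat_def)
  then show "nbr \<omega> x y" using a by (simp add: nbr_def cluster_adj_def)
qed

text \<open>Over an infinite set the sum in \<open>nu\<close> would default to 0; finiteness is what
  lets it dominate each of its terms.\<close>

lemma finite_nbr: "finite {y. nbr \<omega> x y}"
proof (rule finite_subset[OF _ box_card(1)[of x 1]])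
  show "{y. nbr \<omega> x y} \<subseteq> {z. \<forall>i. \<bar>z $ i - x $ i\<bar> \<le> int 1}"
  proof
    fix y assume "y \<in> {y. nbr \<omega> x y}"
    then have "(x, y) \<in> cluster_adj \<omega> ^^ 1" by (simp add: nbr_iff)
    from cluster_adj_relpow_coord[OF this] show "y \<in> {z. \<forall>i. \<bar>z $ i - x $ i\<bar> \<le> int 1}" by blast
  qed
qed

text \<open>By uniqueness the cluster is a single open component, so an open path joins any two of
  its points; every vertex on it belongs to the same component, so the path stays in the
  cluster.\<close>

lemma gdist_finite:
  assumes uniq: "\<exists>!K. K \<in> infinite_components \<omega>"
    and x: "x \<in> inf_cluster \<omega>" and y: "y \<in> inf_cluster \<omega>"
  shows "\<exists>n. gdist \<omega> x y = enat n"
proof -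
  let ?R = "{(u, v). {u, v} \<in> open_edges \<omega>}"
  obtain L where "L \<in> infinite_components \<omega>" "\<And>L'. L' \<in> infinite_components \<omega> \<Longrightarrow> L' = L"
    using uniq by (elim ex1E) metis
  then have "infinite_components \<omega> = {L}" by blast
  then obtain K where K: "infinite_components \<omega> = {K}" by blast
  then have cl: "inf_cluster \<omega> = K" by (simp add: inf_cluster_def)
  obtain a where a: "K = ?R\<^sup>* `` {a}"
    using K unfolding infinite_components_def open_component_def by blast
  have sym: "sym (?R\<^sup>*)" by (intro sym_rtrancl) (auto simp: sym_def insert_commute)
  have "(a, x) \<in> ?R\<^sup>*" "(a, y) \<in> ?R\<^sup>*" using x y cl a by auto
  then have "(x, y) \<in> ?R\<^sup>*" using sym by (meson symD rtrancl_trans)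
  then have "(x, y) \<in> (cluster_adj \<omega>)\<^sup>* \<and> y \<in> inf_cluster \<omega>"
  proof induction
    case (step u v)
    then have "v \<in> inf_cluster \<omega>" using cl a by (auto intro: rtrancl_into_rtrancl)
    moreover from this step have "(u, v) \<in> cluster_adj \<omega>" by (auto simp: cluster_adj_def)
    ultimately show ?case using step by (auto intro: rtrancl_into_rtrancl)
  qed (use x in auto)
  then obtain n where "(x, y) \<in> cluster_adj \<omega> ^^ n" using rtrancl_power by blast
  from gdist_le[OF this] show ?thesis by (cases "gdist \<omega> x y") auto
qed

text \<open>The last vertex but one of a shortest path; were it closer than \<open>j\<close>, the
  path could be shortened.\<close>

lemma gdist_Suc:
  assumes "gdist \<omega> x y = enat (Suc j)"
  shows "\<exists>z. gdist \<omega> x z = enat j \<and> (z, y) \<in> cluster_adj \<omega>"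
proof -
  obtain z where z: "(x, z) \<in> cluster_adj \<omega> ^^ j" "(z, y) \<in> cluster_adj \<omega>"
    using gdist_eq_enatD[OF assms] by auto
  obtain k where k: "gdist \<omega> x z = enat k" "k \<le> j"
    using gdist_le[OF z(1)] by (cases "gdist \<omega> x z") auto
  have "(x, y) \<in> cluster_adj \<omega> ^^ Suc k" using gdist_eq_enatD[OF k(1)] z(2) by auto
  from gdist_le[OF this] assms have "j \<le> k" by simp
  with k z show ?thesis by auto
qed

text \<open>The constants are the infimum of \<open>\<theta>\<close> and the supremum of the
  averaged norms plus 1; the root is the origin.\<close>

lemma rooted_graph_cluster:
  fixes \<omega> :: "'d::finite config"
  assumes zero: "0 \<in> inf_cluster \<omega>"
    and uniq: "\<exists>!K. K \<in> infinite_components \<omega>"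
    and W: "\<forall>x\<in>inf_cluster \<omega>. \<forall>y\<in>inf_cluster \<omega>. 0 < W \<omega> x y"
    and \<theta>_pos: "\<forall>x\<in>inf_cluster \<omega>. 0 < \<theta> x"
    and \<theta>_inf: "0 < (INF y\<in>inf_cluster \<omega>. \<theta> y)"
    and p: "1 < p" and q: "1 < q"
    and sup: "(SUP R\<in>{1..}. ennreal (avg_norm p (gball \<omega> 0 R) (\<lambda>x. max 1 (\<theta> x)) +
                               avg_norm q (gball \<omega> 0 R) (\<lambda>x. max 1 (nu W \<omega> x)))) < \<infinity>"
  shows "\<exists>c M. rooted_graph (inf_cluster \<omega>) (cluster_adj \<omega>) (\<lambda>x. the_enat (gdist \<omega> 0 x)) 0
                 \<theta> (W \<omega>) c M CARD('d)"
proof -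
  define \<rho> where "\<rho> = (\<lambda>x. the_enat (gdist \<omega> 0 x))"
  have gd: "gdist \<omega> 0 x = enat (\<rho> x)" if "x \<in> inf_cluster \<omega>" for x
    using gdist_finite[OF uniq zero that] by (auto simp: \<rho>_def)
  have ball: "gball \<omega> 0 (real n) = {x \<in> inf_cluster \<omega>. \<rho> x \<le> n}" for n
    by (auto simp: gball_def gd)
  have sub: "{x \<in> inf_cluster \<omega>. \<rho> x \<le> n} \<subseteq> {z. \<forall>i. \<bar>z $ i - 0 $ i\<bar> \<le> int n}" for n
  proof safe
    fix z i assume z: "z \<in> inf_cluster \<omega>" "\<rho> z \<le> n"
    have "\<bar>z $ i - 0 $ i\<bar> \<le> int (\<rho> z)"
      by (rule cluster_adj_relpow_coord[OF gdist_eq_enatD[OF gd[OF z(1)]]])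
    then show "\<bar>z $ i - 0 $ i\<bar> \<le> int n" using z(2) by linarith
  qed
  have fin: "finite {x \<in> inf_cluster \<omega>. \<rho> x \<le> n}" for n
    using finite_subset[OF sub box_card(1)] .
  have root: "0 \<in> gball \<omega> 0 (real n)" for n
  proof -
    have "gdist \<omega> 0 0 \<le> enat 0" by (rule gdist_le) simp
    then have "gdist \<omega> 0 0 = 0" by (simp add: zero_enat_def[symmetric])
    then show ?thesis using zero by (simp add: gball_def)
  qed
  obtain M0 where M0: "(SUP R\<in>{1..}. ennreal (avg_norm p (gball \<omega> 0 R) (\<lambda>x. max 1 (\<theta> x)) +
                               avg_norm q (gball \<omega> 0 R) (\<lambda>x. max 1 (nu W \<omega> x)))) = ennreal M0" "0 \<le> M0"
    using sup unfolding infinity_ennreal_def less_top_ennreal by (elim exE conjE)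
  \<comment> \<open>Adding 1 makes the constant strictly positive.\<close>
  define M where "M = M0 + 1"
  have avg: "avg_norm p (gball \<omega> 0 n) (\<lambda>x. max 1 (\<theta> x)) \<le> M"
    "avg_norm q (gball \<omega> 0 n) (\<lambda>x. max 1 (nu W \<omega> x)) \<le> M" if "1 \<le> n" for n :: nat
  proof -
    let ?a = "avg_norm p (gball \<omega> 0 n) (\<lambda>x. max 1 (\<theta> x))"
    let ?b = "avg_norm q (gball \<omega> 0 n) (\<lambda>x. max 1 (nu W \<omega> x))"
    have "ennreal (?a + ?b) \<le> ennreal M0"
      unfolding M0(1)[symmetric] by (rule SUP_upper) (use that in auto)
    then have "?a + ?b \<le> M0" using M0(2) by (simp add: ennreal_le_iff)
    moreover have "0 \<le> ?a" "0 \<le> ?b"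
      using fin[of n] root[of n] by (auto intro!: avg_norm_nonneg simp: ball)
    ultimately show "?a \<le> M" "?b \<le> M" by (auto simp: M_def)
  qed
  have "rooted_graph (inf_cluster \<omega>) (cluster_adj \<omega>) \<rho> 0 \<theta> (W \<omega>)
          (INF y\<in>inf_cluster \<omega>. \<theta> y) M CARD('d)"
  proof
    obtain L where "L \<in> infinite_components \<omega>" using uniq by blast
    then have "infinite L" "L \<subseteq> inf_cluster \<omega>"
      by (auto simp: infinite_components_def inf_cluster_def)
    then show "infinite (inf_cluster \<omega>)" using finite_subset by blast
    show "finite {x \<in> inf_cluster \<omega>. \<rho> x \<le> n}" for n by (rule fin)
    show "card {x \<in> inf_cluster \<omega>. \<rho> x \<le> n} \<le> (2 * n + 1) ^ CARD('d)" for n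
      using card_mono[OF box_card(1) sub] box_card(2) by (rule order_trans)
    show "x = 0" if "x \<in> inf_cluster \<omega>" "\<rho> x = 0" for x
      using gdist_eq_enatD[OF gd[OF that(1)]] that(2) by simp
    show "\<exists>y\<in>inf_cluster \<omega>. \<rho> y = j \<and> (y, x) \<in> cluster_adj \<omega>"
      if x: "x \<in> inf_cluster \<omega>" "\<rho> x = Suc j" for x j
    proof -
      obtain z where "gdist \<omega> 0 z = enat j" "(z, x) \<in> cluster_adj \<omega>"
        using gdist_Suc[of \<omega> 0 x j] gd x by auto
      then show ?thesis by (intro bexI[of _ z]) (auto simp: \<rho>_def cluster_adj_def)
    qed
    show "0 < (INF y\<in>inf_cluster \<omega>. \<theta> y)" by (rule \<theta>_inf)
    show "0 < M" using M0(2) by (simp add: M_def)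
    show "0 < CARD('d)" by simp
    show "(INF y\<in>inf_cluster \<omega>. \<theta> y) \<le> \<theta> x" if "x \<in> inf_cluster \<omega>" for x
    proof (rule cINF_lower[OF _ that])
      \<comment> \<open>The infimum of reals is a lower bound only for sets bounded below;
        positivity of \<open>\<theta>\<close> supplies this.\<close>
      show "bdd_below (\<theta> ` inf_cluster \<omega>)"
        using \<theta>_pos by (intro bdd_belowI[of _ 0]) (auto intro: less_imp_le)
    qed
    show "\<theta> x \<le> M * card {x \<in> inf_cluster \<omega>. \<rho> x \<le> n}"
      if "x \<in> inf_cluster \<omega>" "\<rho> x \<le> n" "1 \<le> n" for x n
      using avg_norm_bound[OF p _ _ avg(1)[OF that(3)], of x] that fin[of n] by (simp add: ball)
    show "0 < W \<omega> x y" if "(x, y) \<in> cluster_adj \<omega>" for x y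
      using W that by (auto simp: cluster_adj_def)
    show "inverse (W \<omega> x y) \<le> M * card {x \<in> inf_cluster \<omega>. \<rho> x \<le> n}"
      if xy: "(x, y) \<in> cluster_adj \<omega>" and x: "\<rho> x \<le> n" "1 \<le> n" for x y n
    proof -
      \<comment> \<open>One inverse weight is a single term of \<open>nu\<close>, whose norm is
        controlled.\<close>
      have "inverse (W \<omega> x y) \<le> nu W \<omega> x"
        unfolding nu_def
      proof (rule member_le_sum[OF _ _ finite_nbr])
        show "y \<in> {y. nbr \<omega> x y}" using xy by (simp add: nbr_iff)
        show "0 \<le> inverse (W \<omega> x z)" if "z \<in> {y. nbr \<omega> x y} - {y}" for z
          using W that by (auto simp: nbr_def intro: less_imp_le)
      qed
      moreover have "x \<in> inf_cluster \<omega>" using xy by (auto simp: cluster_adj_def)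
      ultimately show ?thesis
        using avg_norm_bound[OF q _ _ avg(2)[OF x(2)], of x] x fin[of n] by (simp add: ball)
    qed
  qed
  then show ?thesis unfolding \<rho>_def by blast
qed

section \<open>The inequality on the cluster\<close>

text \<open>Clearing the denominator in \<open>SE\<close> and multiplying by \<open>SU\<close>
  bounds \<open>S ^ (A + 2)\<close>; the root of order \<open>A + 2\<close> gives the claim.\<close>

lemma interpolate:
  fixes S T U E D c :: real
  assumes pos: "0 < S" "0 \<le> T" "0 \<le> U" "0 \<le> E" "0 < D" "0 < c" "0 < A"
    and SU: "S \<le> U\<^sup>2 / c" and SE: "S \<le> D * E * (T / S) ^ A"
  shows "S \<le> (D / c) powr (1 / (A + 2)) *
    (E powr (1 / (A + 2)) * U powr (2 * (1 / (A + 2))) * T powr (A / (A + 2)))"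
proof -
  let ?a = "1 / (real A + 2)"
  \<comment> \<open>As \<open>A\<close> is positive, \<open>T = 0\<close> would make the right side
    of \<open>SE\<close> vanish.\<close>
  have "T \<noteq> 0" using SE pos by (auto simp: zero_power)
  then have T0: "0 < T" using pos by simp
  have "U \<noteq> 0" using SU pos by auto
  then have U0: "0 < U" using pos by simp
  have "S * S ^ A \<le> D * E * (T / S) ^ A * S ^ A"
    using SE pos by (intro mult_right_mono) auto
  also have "\<dots> = D * E * T ^ A" using pos by (simp add: power_divide)
  finally have "S * S ^ A \<le> D * E * T ^ A" .
  from mult_mono[OF this SU] have "(S * S ^ A) * S \<le> (D * E * T ^ A) * (U\<^sup>2 / c)"
    using pos T0 by simp
  then have "S ^ (A + 2) \<le> (D / c) * (E * U\<^sup>2 * T ^ A)"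
    by (simp add: power_add power2_eq_square algebra_simps)
  then have "(S ^ (A + 2)) powr ?a \<le> ((D / c) * (E * U\<^sup>2 * T ^ A)) powr ?a"
    using pos by (intro powr_mono2) auto
  moreover have "(S ^ (A + 2)) powr ?a = S"
  proof -
    have "(S ^ (A + 2)) powr ?a = S powr (real (A + 2) * ?a)"
      using pos by (subst powr_realpow[symmetric]) (auto simp: powr_powr)
    also have "real (A + 2) * ?a = 1" by (simp add: field_simps)
    finally show ?thesis using pos by simp
  qed
  moreover have "(U\<^sup>2) powr ?a = U powr (2 * ?a)"
    using powr_powr[of U 2 ?a] U0 by simp
  moreover have "(T ^ A) powr ?a = T powr (A * ?a)"
    using T0 by (subst powr_realpow[symmetric]) (auto simp: powr_powr)
  moreover have "((D / c) * (E * U\<^sup>2 * T ^ A)) powr ?a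
      = (D / c) powr ?a * (E powr ?a * (U\<^sup>2) powr ?a * (T ^ A) powr ?a)"
    by (simp only: powr_mult)
  ultimately show ?thesis by simp
qed

lemma epowr_ennreal: "0 \<le> x \<Longrightarrow> ennreal x epowr a = ennreal (x powr a)"
  by (simp add: epowr_def)

text \<open>Either a factor on the right is infinite and the bound is trivial, or all quantities are
  finite and the real estimates apply.\<close>

lemma weighted_inequality:
  fixes \<omega> :: "'d::finite config"
  assumes rg: "rooted_graph (inf_cluster \<omega>) (cluster_adj \<omega>) (\<lambda>x. the_enat (gdist \<omega> 0 x)) 0
                 (\<theta> \<omega>) (W \<omega>) c M d"
    and zero: "0 \<in> inf_cluster \<omega>" and uniq: "\<exists>!K. K \<in> infinite_components \<omega>"
    and m: "1 \<le> m"
  defines "A \<equiv> 6 * d + 2 * d\<^sup>2"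
  defines "a \<equiv> 1 / (real A + 2)"
  shows "\<exists>C>0. \<forall>f. (lp_norm 2 (inf_cluster \<omega>) (\<theta> \<omega>) (\<lambda>x. ennreal \<bar>f x\<bar>))\<^sup>2 \<le>
          ennreal C *
            (energy W \<omega> f epowr a \<odot>
             lp_norm 1 (inf_cluster \<omega>) (\<theta> \<omega>) (\<lambda>x. ennreal \<bar>f x\<bar>) epowr (2 * a) \<odot>
             lp_norm 2 (inf_cluster \<omega>) (\<theta> \<omega>)
               (\<lambda>x. eta \<omega> x epowr (m / 2) * ennreal \<bar>f x\<bar>) epowr (2 * (A / (real A + 2))))"
    (is "\<exists>C>0. \<forall>f. ?l f \<le> ennreal C * ?r f")
proof -
  define \<rho> where "\<rho> = (\<lambda>x. the_enat (gdist \<omega> 0 x))"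
  interpret rooted_graph "inf_cluster \<omega>" "cluster_adj \<omega>" \<rho> 0 "\<theta> \<omega>" "W \<omega>" c M d
    using rg unfolding \<rho>_def .
  let ?K = "inf_cluster \<omega>" and ?C = "(energy_const / c) powr a"
  have \<theta>0: "0 \<le> \<theta> \<omega> x" if "x \<in> ?K" for x using \<theta>_ge[OF that] c_pos by simp
  have eta: "eta \<omega> x = ennreal (max 1 (real (\<rho> x)))" if "x \<in> ?K" for x
  proof -
    obtain n where n: "gdist \<omega> 0 x = enat n" using gdist_finite[OF uniq zero \<open>x \<in> ?K\<close>] by blast
    have "max (ennreal 1) (ennreal (real n)) = ennreal (max 1 (real n))"
      by (intro max_of_mono monoI ennreal_leI)
    with n show ?thesis by (simp add: eta_def \<rho>_def ennreal_of_nat_eq_real_of_nat)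
  qed
  have "?l f \<le> ennreal ?C * ?r f" for f
  proof -
    let ?s = "\<lambda>x. \<theta> \<omega> x * (f x)\<^sup>2" and ?u = "\<lambda>x. \<theta> \<omega> x * \<bar>f x\<bar>"
      and ?t = "\<lambda>x. \<theta> \<omega> x * (max 1 (real (\<rho> x)) powr m * (f x)\<^sup>2)"
    define Si where "Si = (\<Sum>\<^sub>\<infinity>x\<in>?K. ennreal (?s x))"
    define Ui where "Ui = (\<Sum>\<^sub>\<infinity>x\<in>?K. ennreal (?u x))"
    define Ti where "Ti = (\<Sum>\<^sub>\<infinity>x\<in>?K. ennreal (?t x))"
    define I where "I = (\<Sum>\<^sub>\<infinity>(x, y)\<in>{(x, y). nbr \<omega> x y}. ennreal (W \<omega> x y * (f y - f x)\<^sup>2))"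
    have S_eq: "lp_norm 2 ?K (\<theta> \<omega>) (\<lambda>x. ennreal \<bar>f x\<bar>) = Si epowr (1 / 2)"
      unfolding lp_norm_def Si_def using \<theta>0
      by (intro arg_cong[where f = "\<lambda>z. z epowr _"] infsum_cong)
         (simp add: epowr_ennreal ennreal_mult'[symmetric] mult.commute)
    have U_eq: "lp_norm 1 ?K (\<theta> \<omega>) (\<lambda>x. ennreal \<bar>f x\<bar>) = Ui epowr 1"
      unfolding lp_norm_def Ui_def div_by_1 using \<theta>0
      by (intro arg_cong[where f = "\<lambda>z. z epowr _"] infsum_cong)
         (simp add: epowr_ennreal ennreal_mult'[symmetric] mult.commute)
    have T_eq: "lp_norm 2 ?K (\<theta> \<omega>) (\<lambda>x. eta \<omega> x epowr (m / 2) * ennreal \<bar>f x\<bar>) = Ti epowr (1 / 2)"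
      unfolding lp_norm_def Ti_def
    proof (intro arg_cong[where f = "\<lambda>z. z epowr _"] infsum_cong)
      fix x assume x: "x \<in> ?K"
      let ?e = "max 1 (real (\<rho> x))"
      have "(eta \<omega> x epowr (m / 2) * ennreal \<bar>f x\<bar>) epowr 2 = ennreal ((?e powr (m / 2) * \<bar>f x\<bar>) powr 2)"
        using x by (simp add: eta epowr_ennreal ennreal_mult'[symmetric])
      also have "(?e powr (m / 2) * \<bar>f x\<bar>) powr 2 = ?e powr m * (f x)\<^sup>2"
        by (simp add: powr_mult powr_powr)
      finally show "(eta \<omega> x epowr (m / 2) * ennreal \<bar>f x\<bar>) epowr 2 * ennreal (\<theta> \<omega> x) = ennreal (?t x)"
        using \<theta>0[OF x] by (simp add: ennreal_mult'[symmetric] mult.commute)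
    qed
    \<comment> \<open>Finiteness of the weighted norm thus passes to the l2 norm on the
      left.\<close>
    have "Si \<le> Ti" unfolding Si_def Ti_def
    proof (intro infsum_mono nonneg_summable_on_complete ennreal_leI)
      fix x assume x: "x \<in> ?K"
      have "1 \<le> max 1 (real (\<rho> x)) powr m" using m by (intro ge_one_powr_ge_zero) auto
      then have "1 * (f x)\<^sup>2 \<le> max 1 (real (\<rho> x)) powr m * (f x)\<^sup>2"
        by (intro mult_right_mono) auto
      then show "?s x \<le> ?t x" using \<theta>0[OF x] by (intro mult_left_mono) auto
    qed auto
    show ?thesis
    \<comment> \<open>The operation \<open>\<odot>\<close> makes the right side infinite as soon as
      one factor is, even if another one vanishes.\<close>
    proof (cases "Ti = \<infinity> \<or> Ui = \<infinity> \<or> I = \<infinity>")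
      case True
      have "energy W \<omega> f = \<infinity>" if "I = \<infinity>"
        using that unfolding energy_def I_def[symmetric] by (simp add: ennreal_mult_eq_top_iff ennreal_divide_eq_0_iff)
      then have "?r f = \<infinity>" using True
        unfolding U_eq T_eq by (auto simp: times_inf_def epowr_def)
      moreover have "0 < ?C" using energy_const_pos c_pos by simp
      ultimately show ?thesis by (simp add: ennreal_mult_top)
    next
      case False
      then have fin: "Ti < \<infinity>" "Ui < \<infinity>" "I < \<infinity>" by (auto simp: less_top)
      obtain T where T: "Ti = ennreal T" "0 \<le> T" using fin(1) by (cases Ti) auto
      obtain U where U: "Ui = ennreal U" "0 \<le> U" using fin(2) by (cases Ui) auto
      obtain i where i: "I = ennreal i" "0 \<le> i" using fin(3) by (cases I) auto
      obtain S where S: "Si = ennreal S" "0 \<le> S" using \<open>Si \<le> Ti\<close> fin(1) by (cases Si) auto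
      define E where "E = i / 2"
      have E: "energy W \<omega> f = ennreal E" "0 \<le> E"
        unfolding energy_def I_def[symmetric] E_def i(1)
        using i(2) divide_ennreal[of 1 2] ennreal_mult'[of "1 / 2" i] by simp_all
      have l: "?l f = ennreal S"
        using S(2) unfolding S_eq S(1) by (simp add: epowr_ennreal ennreal_power powr_half_sqrt)
      have r: "?r f = ennreal (E powr a * U powr (2 * a) * T powr (A / (real A + 2)))"
        unfolding U_eq T_eq U(1) T(1) E(1) using U(2) T(2) E(2)
        by (simp add: epowr_ennreal times_inf_def ennreal_mult'[symmetric] powr_powr)
      show ?thesis
      \<comment> \<open>The abstract estimates divide by \<open>S\<close>; for \<open>S = 0\<close>
        the left side vanishes.\<close>
      proof (cases "S = 0")
        case False
        then have S0: "0 < S" using S(2) by simp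
        note nn = mult_nonneg_nonneg[OF \<theta>0]
        have Siff: "S \<le> b \<longleftrightarrow> (\<forall>F. finite F \<and> F \<subseteq> ?K \<longrightarrow> sum ?s F \<le> b)" for b
          by (rule infsum_ennreal_real_iff[OF S(1)[unfolded Si_def] S(2)]) (auto intro!: nn)
        have Uiff: "U \<le> b \<longleftrightarrow> (\<forall>F. finite F \<and> F \<subseteq> ?K \<longrightarrow> sum ?u F \<le> b)" for b
          by (rule infsum_ennreal_real_iff[OF U(1)[unfolded Ui_def] U(2)]) (auto intro!: nn)
        have Tiff: "T \<le> b \<longleftrightarrow> (\<forall>F. finite F \<and> F \<subseteq> ?K \<longrightarrow> sum ?t F \<le> b)" for b
          by (rule infsum_ennreal_real_iff[OF T(1)[unfolded Ti_def] T(2)]) (auto intro!: nn)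
        \<comment> \<open>One edge contributes at most the full sum over ordered pairs, which is
          \<open>2 * E\<close> because of the factor 1/2 in the energy.\<close>
        have edge: "W \<omega> x y * (f y - f x)\<^sup>2 \<le> 2 * E" if "(x, y) \<in> cluster_adj \<omega>" for x y
        proof -
          let ?h = "\<lambda>(x, y). ennreal (W \<omega> x y * (f y - f x)\<^sup>2)"
          have "infsum ?h {(x, y). nbr \<omega> x y} \<le> I" by (simp add: I_def)
          from this[unfolded infsum_ennreal_le_iff, rule_format, of "{(x, y)}"] that
          have "ennreal (W \<omega> x y * (f y - f x)\<^sup>2) \<le> I" by (simp add: nbr_iff)
          then show ?thesis using i by (simp add: E_def ennreal_le_iff)
        qed
        have S_lub: "S \<le> b" if "\<And>F. finite F \<Longrightarrow> F \<subseteq> ?K \<Longrightarrow> sum ?s F \<le> b" for b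
          unfolding Siff using that by simp
        have S_upper: "sum ?s F \<le> S" and U_upper: "sum ?u F \<le> U" and T_upper: "sum ?t F \<le> T"
          if "finite F" "F \<subseteq> ?K" for F
          using Siff[of S] Uiff[of U] Tiff[of T] that by simp_all
        have "S \<le> U\<^sup>2 / c"
          by (intro S_lub l2_le_l1 U_upper)
        moreover have "S \<le> energy_const * E * (T / S) ^ A" unfolding A_def
          by (rule energy_lower_bound[where m = m and f = f, OF m S0 S_lub S_upper T_upper edge E(2)])
        moreover have "0 < A" using d_pos by (simp add: A_def)
        ultimately have "S \<le> ?C * (E powr a * U powr (2 * a) * T powr (A / (real A + 2)))"
          unfolding a_def using S0 T(2) U(2) E(2) energy_const_pos c_pos
          by (intro interpolate) auto
        then show ?thesis unfolding l r by (simp add: ennreal_mult'[symmetric] ennreal_leI)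
      qed (simp add: l)
    qed
  qed
  moreover have "0 < ?C" using energy_const_pos c_pos by simp
  ultimately show ?thesis by blast
qed

theorem theorem1p14:
  fixes P :: "'d::finite config measure"
    and W :: "'d config \<Rightarrow> 'd lattice \<Rightarrow> 'd lattice \<Rightarrow> real"
    and \<theta> :: "'d config \<Rightarrow> 'd lattice \<Rightarrow> real"
    and p q :: ennreal
  assumes "CARD('d) \<ge> 2"
    and "prob_space P" and "sets P = sets config_space"
    and "ergodic_inf_cluster P"
    and "large_scale_regular P"
    and "AE \<omega> in cond_meas P. \<forall>x\<in>inf_cluster \<omega>. \<forall>y\<in>inf_cluster \<omega>.
           0 < W \<omega> x y \<and> W \<omega> x y = W \<omega> y x"
    and "AE \<omega> in cond_meas P. \<forall>x\<in>inf_cluster \<omega>. 0 < \<theta> \<omega> x"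
    and "AE \<omega> in cond_meas P. 0 < (INF y\<in>inf_cluster \<omega>. \<theta> \<omega> y)"
    and "1 < p" and "1 < q" and "1 / p + 1 / q < 2 / of_nat CARD('d)"
    and "AE \<omega> in cond_meas P.
           (SUP R\<in>{1..}. ennreal (avg_norm p (gball \<omega> 0 R) (\<lambda>x. max 1 (\<theta> \<omega> x)) +
                                  avg_norm q (gball \<omega> 0 R) (\<lambda>x. max 1 (nu W \<omega> x)))) < \<infinity>"
  shows "\<forall>m::real. m \<ge> 2 \<longrightarrow>
    (\<exists>\<alpha> \<beta> \<gamma> :: real. \<alpha> \<in> {0<..<1} \<and> \<beta> \<in> {0<..<1} \<and> \<gamma> \<in> {0<..<1} \<and> \<alpha> + \<beta> + \<gamma> = 1 \<and>
      (AE \<omega> in cond_meas P. \<exists>C::real. 0 < C \<and>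
        (\<forall>f :: 'd lattice \<Rightarrow> real.
          (lp_norm 2 (inf_cluster \<omega>) (\<theta> \<omega>) (\<lambda>x. ennreal \<bar>f x\<bar>))\<^sup>2 \<le>
          ennreal C *
            (energy W \<omega> f epowr \<alpha> \<odot>
             lp_norm 1 (inf_cluster \<omega>) (\<theta> \<omega>) (\<lambda>x. ennreal \<bar>f x\<bar>) epowr (2 * \<beta>) \<odot>
             lp_norm 2 (inf_cluster \<omega>) (\<theta> \<omega>)
               (\<lambda>x. eta \<omega> x epowr (m / 2) * ennreal \<bar>f x\<bar>) epowr (2 * \<gamma>)))))"
proof (intro allI impI, goal_cases)
  case (1 m)
  \<comment> \<open>The exponents depend on the dimension alone, so they can be fixed before the
    configuration.\<close>
  define A where "A = 6 * CARD('d) + 2 * CARD('d)\<^sup>2"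
  define a where "a = 1 / (real A + 2)"
  define g where "g = A / (real A + 2)"
  have "0 < A" by (simp add: A_def)
  then have a: "a \<in> {0<..<1}" and g: "g \<in> {0<..<1}" by (auto simp: a_def g_def)
  have sum: "a + a + g = 1"
    by (simp add: a_def g_def add_divide_distrib[symmetric] divide_eq_1_iff add.commute)
  interpret prob_space P by fact
  let ?Z = "{\<omega> \<in> space P. 0 \<in> inf_cluster \<omega>}"
  have Z: "measure P ?Z > 0"
    and uniq: "AE \<omega> in P. inf_cluster \<omega> \<noteq> {} \<and> (\<exists>!K. K \<in> infinite_components \<omega>)"
    using assms(4) by (auto simp: ergodic_inf_cluster_def)
  \<comment> \<open>The conditioning event has positive probability, so almost surely under
    \<open>cond_meas P\<close> means almost surely on that event.\<close>
  have AE_cond: "(AE \<omega> in cond_meas P. Q \<omega>) \<longleftrightarrow> (AE \<omega> in P. \<omega> \<in> ?Z \<longrightarrow> Q \<omega>)" for Q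
    unfolding cond_meas_def using Z by (intro AE_uniform_measure) (auto simp: emeasure_eq_measure)
  have "AE \<omega> in cond_meas P. 0 \<in> inf_cluster \<omega> \<and> (\<exists>!K. K \<in> infinite_components \<omega>)"
    unfolding AE_cond using uniq by eventually_elim auto
  with assms(6-8,12) have main: "AE \<omega> in cond_meas P. \<exists>C::real. 0 < C \<and>
        (\<forall>f :: 'd lattice \<Rightarrow> real.
          (lp_norm 2 (inf_cluster \<omega>) (\<theta> \<omega>) (\<lambda>x. ennreal \<bar>f x\<bar>))\<^sup>2 \<le>
          ennreal C *
            (energy W \<omega> f epowr a \<odot>
             lp_norm 1 (inf_cluster \<omega>) (\<theta> \<omega>) (\<lambda>x. ennreal \<bar>f x\<bar>) epowr (2 * a) \<odot>
             lp_norm 2 (inf_cluster \<omega>) (\<theta> \<omega>)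
               (\<lambda>x. eta \<omega> x epowr (m / 2) * ennreal \<bar>f x\<bar>) epowr (2 * g)))"
  proof eventually_elim
    case (elim \<omega>)
    then have zero: "0 \<in> inf_cluster \<omega>" and uniq: "\<exists>!K. K \<in> infinite_components \<omega>" by simp_all
    have W: "\<forall>x\<in>inf_cluster \<omega>. \<forall>y\<in>inf_cluster \<omega>. 0 < W \<omega> x y" using elim(1) by simp
    obtain c M where rg: "rooted_graph (inf_cluster \<omega>) (cluster_adj \<omega>) (\<lambda>x. the_enat (gdist \<omega> 0 x)) 0
                 (\<theta> \<omega>) (W \<omega>) c M CARD('d)"
      using rooted_graph_cluster[OF zero uniq W elim(2,3) assms(9,10) elim(4)] by (elim exE)
    have "1 \<le> m" using 1 by simp
    then show ?case
      unfolding a_def g_def A_def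
      by (rule weighted_inequality[where W = W and \<theta> = \<theta> and m = m, OF rg zero uniq])
  qed
  show ?case
    by (rule exI[of _ a], rule exI[of _ a], rule exI[of _ g], intro conjI a g sum main)
qed

end
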